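(* Let $k,n\in\mathbb N$, and let $G$ be a graph of order $n$ such that at least $n/2$ vertices of $G$ have degree at least $k$. Then every tree of diameter at most $5$ and with at most $k$ edges is a subgraph of $G$.
   Context: Here $\mathbb N=\{1,2,3,\dots\}$. Graphs are finite, simple and undirected; the order of a graph is its number of vertices. A graph $H$ is called a subgraph of $G$ if there is an injective map $V(H)\to V(G)$ that preserves adjacencies (so containment is up to isomorphism and need not be induced). The diameter of a graph is the longest distance between any two of its vertices, where distance is the number of edges of a shortest path. *)

theory Defs
  imports "Graph_Theory.Graph_Theory"
begin

text \<open>
  Finite simple undirected graphs are the \<open>pair_graph\<close>s of \<^theory>\<open>Graph_Theory.Pair_Digraph\<close>:
  finite, loop-free and symmetric, without parallel arcs. An undirected edge \<open>uv\<close> is represented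
  by the two arcs \<open>(u, v)\<close> and \<open>(v, u)\<close>, so edges must not be counted as arcs.
\<close>

definition undirected_edges :: "'a pair_pre_digraph \<Rightarrow> 'a set set" where
  "undirected_edges G = {{u, v} | u v. (u, v) \<in> parcs G}"

text \<open>In a symmetric digraph the out-degree is the number of neighbours, i.e. the degree.\<close>

lemma out_degree_eq_card_neighbours:
  "out_degree (with_proj G) v = card {w. (v, w) \<in> parcs G}"
proof -
  have "out_arcs (with_proj G) v = Pair v ` {w. (v, w) \<in> parcs G}"
    by (auto simp: out_arcs_def)
  then show ?thesis
    by (simp add: out_degree_def card_image inj_on_def)
qed

text \<open>
  The predicate \<^const>\<open>tree\<close> of the library is not usable here: in a symmetric digraph every edge
  \<open>uv\<close> gives a closed walk \<open>u, v, u\<close>, which \<^const>\<open>pre_digraph.cycle\<close> counts as a cycle. Cycles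
  of an undirected graph are those of length at least 3. Note that \<^const>\<open>Digraph_Component.connected\<close>
  requires a nonempty vertex set.
\<close>

definition undirected_tree :: "'a pair_pre_digraph \<Rightarrow> bool" where
  "undirected_tree T \<longleftrightarrow>
     pair_graph T \<and> Digraph_Component.connected (with_proj T) \<and>
     \<not> (\<exists>p. pre_digraph.cycle (with_proj T) p \<and> length p \<ge> 3)"

text \<open>The library's \<open>\<mu>\<close> with all arc weights 1; it is infinite for unreachable pairs.\<close>

definition graph_dist :: "'a pair_pre_digraph \<Rightarrow> 'a \<Rightarrow> 'a \<Rightarrow> ereal" where
  "graph_dist G u v = wf_digraph.\<mu> (with_proj G) (\<lambda>_. 1) u v"

definition graph_diameter :: "'a pair_pre_digraph \<Rightarrow> ereal" where
  "graph_diameter G = (SUP u\<in>pverts G. SUP v\<in>pverts G. graph_dist G u v)"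

text \<open>Containment up to isomorphism, not necessarily induced.\<close>

definition contained_in :: "'b pair_pre_digraph \<Rightarrow> 'a pair_pre_digraph \<Rightarrow> bool" where
  "contained_in H G \<longleftrightarrow>
     (\<exists>f. inj_on f (pverts H) \<and> f ` pverts H \<subseteq> pverts G \<and>
          (\<forall>u v. (u, v) \<in> parcs H \<longrightarrow> (f u, f v) \<in> parcs G))"

end

theory Submission
  imports Defs
begin

text \<open>
  Let \<open>L\<close> be the set of vertices of \<open>G\<close> of degree at least \<open>k\<close>, so \<open>L\<close> contains at least half of
  all vertices. A tree with at most \<open>k\<close> edges embeds into \<open>G\<close> as soon as its non-leaf vertices can
  be placed in \<open>L\<close>: leaves can be attached greedily at the very end (\<open>attach_leaves\<close>).

  A tree of diameter at most 5 has a central edge \<open>r1 r2\<close> such that every vertex is within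
  distance 2 of \<open>r1\<close> or \<open>r2\<close> (\<open>exists_central_edge\<close>, \<open>exists_two_rooted_structure\<close>). Let
  \<open>V1\<close>, \<open>V2\<close> be the children of the two roots and \<open>W1\<close>, \<open>W2\<close> their grandchildren. As these are at
  most \<open>k - 1\<close> vertices, one may assume \<open>|V2| + |W1| < k/2\<close>; in particular the roots have fewer than
  \<open>k/2\<close> non-leaf children altogether.

  Let \<open>C\<close> be the set of vertices outside \<open>L\<close> with at least \<open>k/2\<close> neighbours in \<open>L\<close>. Either of the
  following edges \<open>v u\<close> of \<open>G\<close> with \<open>v \<in> L\<close> can play the role of the central edge:

  \<^item> \<open>u \<in> L\<close>, where \<open>u\<close> has at least \<open>k/2\<close> and \<open>v\<close> at least \<open>k/4\<close> neighbours in \<open>L\<close>. The root with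
    fewer non-leaf children goes to \<open>v\<close>, and all inner vertices go to \<open>L\<close>
    (\<open>embedding_if_inner_in_L\<close>).
  \<^item> \<open>u \<in> C\<close>, where \<open>v\<close> has at least \<open>k/2\<close> neighbours in \<open>L \<union> C\<close>. Then \<open>r2\<close> goes to \<open>u\<close>, and the
    bound on \<open>|V2| + |W1|\<close> leaves room in \<open>L\<close> for all children of vertices placed in \<open>C\<close>
    (\<open>embedding_if_root_in_C\<close>).

  An edge of one of these two kinds exists by a weighted count of the edges between \<open>L\<close> and its
  complement (\<open>exists_dense_edge\<close>).
\<close>

section \<open>Dense edges of a graph half of whose vertices have large degree\<close>

text \<open>
  The crudest form of Hall's theorem: if every candidate set is as large as the whole index set, the
  representatives can be picked one after the other.
\<close>

lemma distinct_representatives: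
  assumes "finite M"
    and "\<And>m. m \<in> M \<Longrightarrow> finite (N m)"
    and "\<And>m. m \<in> M \<Longrightarrow> card M \<le> card (N m - F)"
  shows "\<exists>g. inj_on g M \<and> (\<forall>m\<in>M. g m \<in> N m - F)"
  using assms
proof (induction M)
  case empty
  then show ?case by simp
next
  case (insert x M)
  have "card M \<le> card (N m - F)" if "m \<in> M" for m
    using insert.prems(2)[of m] insert.hyps that by simp
  then obtain g where g: "inj_on g M" "\<forall>m\<in>M. g m \<in> N m - F"
    using insert.IH insert.prems(1) by auto
  have "card (g ` M) < card (N x - F)"
    using insert.prems(2)[of x] insert.hyps card_image_le[of M g] by simp
  then have "\<not> N x - F \<subseteq> g ` M"
    using card_mono[of "g ` M" "N x - F"] insert.hyps(1) by auto
  then obtain y where y: "y \<in> N x - F" "y \<notin> g ` M" by blast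
  have "(g(x := y)) ` M = g ` M" "inj_on (g(x := y)) M"
    using insert.hyps(2) g(1) by (auto simp: inj_on_def)
  then have "inj_on (g(x := y)) (insert x M)"
    using y(2) insert.hyps(2) by simp
  moreover have "\<forall>m\<in>insert x M. (g(x := y)) m \<in> N m - F"
    using g(2) y(1) by auto
  ultimately show ?case by blast
qed

locale finite_graph =
  fixes V :: "'a set" and E :: "'a \<Rightarrow> 'a \<Rightarrow> bool"
  assumes finite_V: "finite V"
    and E_in_V: "E x y \<Longrightarrow> x \<in> V"
    and E_sym: "E x y \<Longrightarrow> E y x"
    and E_irrefl: "\<not> E x x"
begin

definition nbrs :: "'a set \<Rightarrow> 'a \<Rightarrow> 'a set" where
  "nbrs U x = {y \<in> U. E x y}"

lemma finite_nbrs [simp]: "finite (nbrs U x)"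
  by (rule finite_subset[OF _ finite_V]) (auto simp: nbrs_def intro: E_in_V E_sym)

lemma nbrs_mono: "U \<subseteq> U' \<Longrightarrow> nbrs U x \<subseteq> nbrs U' x"
  by (auto simp: nbrs_def)

lemma card_nbrs_Un_disjoint:
  assumes "U \<inter> U' = {}"
  shows "card (nbrs (U \<union> U') x) = card (nbrs U x) + card (nbrs U' x)"
proof -
  have "nbrs (U \<union> U') x = nbrs U x \<union> nbrs U' x" "nbrs U x \<inter> nbrs U' x = {}"
    using assms by (auto simp: nbrs_def)
  then show ?thesis by (simp add: card_Un_disjoint)
qed

text \<open>
  Embeddings are built greedily, so one always has to bound from below the neighbours of \<open>x\<close>
  in \<open>U\<close> that are not used yet. The used vertex \<open>x\<close> itself costs nothing, since there
  are no loops. This saving of one is what makes the strict inequalities below sufficient.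
\<close>

lemma card_nbrs_Diff_ge:
  assumes "finite F" and "card (F \<inter> U - {x}) + m \<le> card (nbrs U x)"
  shows "m \<le> card (nbrs U x - F)"
proof -
  have "nbrs U x - F = nbrs U x - (F \<inter> U - {x})"
    using E_irrefl by (auto simp: nbrs_def)
  then show ?thesis
    using diff_card_le_card_Diff[of "F \<inter> U - {x}" "nbrs U x"] assms by simp
qed

text \<open>
Both sides count the edges between \<open>A\<close> and \<open>B\<close>.
\<close>

lemma sum_card_nbrs_swap:
  assumes "finite A" "finite B"
  shows "(\<Sum>x\<in>A. card (nbrs B x)) = (\<Sum>y\<in>B. card (nbrs A y))"
proof -
  have 1: "card (nbrs B x) = (\<Sum>y\<in>B. if E x y then 1 else 0)" for x
    using assms by (simp add: nbrs_def sum.If_cases Int_def)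
  have 2: "card (nbrs A y) = (\<Sum>x\<in>A. if E x y then 1 else 0)" for y
  proof -
    have "nbrs A y = {x \<in> A. E x y}" by (auto simp: nbrs_def intro: E_sym)
    then show ?thesis using assms by (simp add: sum.If_cases Int_def)
  qed
  show ?thesis unfolding 1 2 by (rule sum.swap)
qed

text \<open>
  Suppose that there is no such edge. Let \<open>D\<close> be the vertices outside \<open>L\<close> with fewer than
  \<open>k/2\<close> neighbours in \<open>L\<close>, let \<open>B\<close> be the vertices of \<open>L\<close> with at least \<open>k/2\<close>
  neighbours in \<open>L\<close>, and \<open>N\<close> the neighbours of \<open>B\<close> in \<open>L\<close>. The missing edges say
  that vertices of \<open>N\<close> have fewer than \<open>k/4\<close> neighbours in \<open>L\<close>, that there is no edge
  between \<open>B\<close> and \<open>C\<close>, and that vertices of \<open>L - B\<close> have fewer than \<open>k/2\<close> neighbours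
  in \<open>L \<union> C\<close>.

  Now count the edges between \<open>L\<close> and its complement, giving weight 2 to those that end in
  \<open>D\<close> and weight 1 to those that end in \<open>C\<close>. A vertex outside \<open>L\<close> receives weight at most
  \<open>k - 1\<close>. A vertex of \<open>L\<close> sends weight at least \<open>k\<close>, except that \<open>v \<in> B\<close> may fall short
  by its number of neighbours in \<open>N\<close>; but each vertex of \<open>N\<close> sends a surplus of at least its
  number of neighbours in \<open>B\<close>, and by double counting these two corrections cancel. Hence
  \<open>k |L| \<le> (k - 1) |V - L|\<close>, which is impossible as \<open>L\<close> contains half of the vertices.
\<close>

lemma exists_dense_edge:
  fixes k :: nat
  assumes "k \<ge> 1" "V \<noteq> {}"
    and L_def: "L = {v \<in> V. k \<le> card (nbrs V v)}"
    and C_def: "C = {x \<in> V - L. k \<le> 2 * card (nbrs L x)}"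
    and half: "card V \<le> 2 * card L"
  obtains u v where "E u v" "v \<in> L"
    and "u \<in> L \<and> k \<le> 2 * card (nbrs L u) \<and> k \<le> 4 * card (nbrs L v)
       \<or> u \<in> C \<and> k \<le> 2 * card (nbrs (L \<union> C) v)"
proof (rule ccontr)
  note dense_edge = that
  assume "\<not> thesis"
  then have no_edge: "\<not> (u \<in> L \<and> k \<le> 2 * card (nbrs L u) \<and> k \<le> 4 * card (nbrs L v))"
      "\<not> (u \<in> C \<and> k \<le> 2 * card (nbrs (L \<union> C) v))" if "E u v" "v \<in> L" for u v
    using dense_edge[OF that] by blast+
  define D where "D = V - L - C"
  define B where "B = {v \<in> L. k \<le> 2 * card (nbrs L v)}"
  define N where "N = {v \<in> L. \<exists>u\<in>B. E u v}"
  have fin: "finite L" "finite C" "finite D" "finite B" "finite N"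
    using finite_V by (auto simp: L_def C_def D_def B_def N_def)
  have "B \<subseteq> L" "N \<subseteq> L" by (auto simp: B_def N_def)
  have V_split: "V = L \<union> C \<union> D" "L \<inter> C = {}" "(L \<union> C) \<inter> D = {}"
    by (auto simp: L_def C_def D_def)
  have deg: "card (nbrs V x) = card (nbrs L x) + card (nbrs C x) + card (nbrs D x)"
    and degLC: "card (nbrs (L \<union> C) x) = card (nbrs L x) + card (nbrs C x)" for x
    using V_split by (simp_all add: card_nbrs_Un_disjoint)
  have N_sparse: "4 * card (nbrs L v) < k" if "v \<in> N" for v
  proof -
    obtain u where "u \<in> B" "E u v" "v \<in> L" using \<open>v \<in> N\<close> by (auto simp: N_def)
    then show ?thesis using no_edge(1)[of u v] by (auto simp: B_def)
  qed
  have no_C: "nbrs C v = {}" if "v \<in> L" "k \<le> 2 * card (nbrs (L \<union> C) v)" for v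
  proof (rule ccontr)
    assume "nbrs C v \<noteq> {}"
    then obtain u where "u \<in> C" "E v u" by (auto simp: nbrs_def)
    then show False using no_edge(2)[OF E_sym] that by blast
  qed
  have A_sparse: "2 * (card (nbrs L v) + card (nbrs C v)) < k" if "v \<in> L - B" for v
  proof (rule ccontr)
    assume "\<not> ?thesis"
    then have "nbrs C v = {}" "k \<le> 2 * card (nbrs (L \<union> C) v)"
      using that no_C[of v] degLC[of v] by auto
    then show False using that degLC[of v] by (simp add: B_def)
  qed
  have L_deg: "k \<le> card (nbrs L v) + card (nbrs C v) + card (nbrs D v)" if "v \<in> L" for v
    using that deg[of v] by (simp add: L_def)
  have B_N_disjoint: "B \<inter> N = {}"
  proof (rule ccontr)
    assume "B \<inter> N \<noteq> {}"
    then obtain v where "v \<in> B" "v \<in> N" by blast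
    then show False using N_sparse[of v] by (simp add: B_def)
  qed
  have nbrs_B: "nbrs L v = nbrs N v" if "v \<in> B" for v
    using that by (auto simp: nbrs_def N_def)
  have B_no_C: "nbrs C v = {}" if "v \<in> B" for v
    using that no_C[of v] degLC[of v] by (auto simp: B_def)
  have nbrs_BL: "card (nbrs B v) \<le> card (nbrs L v)" for v
    by (intro card_mono nbrs_mono) (auto simp: B_def)
  (* The first summand on either side of the inequality is the ideal weight balance; the second
     one is the surplus of N on the left and the permitted shortfall of B on the right. *)
  let ?w = "\<lambda>v. 2 * card (nbrs D v) + card (nbrs C v)"
  have weight: "k + (if v \<in> N then card (nbrs B v) else 0)
      \<le> ?w v + (if v \<in> B then card (nbrs N v) else 0)" if v: "v \<in> L" for v
  proof (cases "v \<in> B")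
    case True
    then show ?thesis
      using L_deg[OF v] B_no_C[OF True] nbrs_B[OF True] B_N_disjoint by auto
  next
    case False
    then have "v \<in> L - B" using v by simp
    from A_sparse[OF this] show ?thesis
      using L_deg[OF v] N_sparse[of v] nbrs_BL[of v] False by auto
  qed
  have restrict: "(\<Sum>v\<in>L. if v \<in> M then f v else 0) = (\<Sum>v\<in>M. f v)" if "M \<subseteq> L"
    for M and f :: "'a \<Rightarrow> nat"
    using that fin(1) by (simp add: sum.If_cases Int_absorb1)
  have "card L * k + (\<Sum>v\<in>N. card (nbrs B v))
      = (\<Sum>v\<in>L. k + (if v \<in> N then card (nbrs B v) else 0))"
    by (simp add: sum.distrib restrict \<open>N \<subseteq> L\<close>)
  also have "\<dots> \<le> (\<Sum>v\<in>L. ?w v + (if v \<in> B then card (nbrs N v) else 0))"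
    by (rule sum_mono) (rule weight)
  also have "\<dots> = (\<Sum>v\<in>L. ?w v) + (\<Sum>v\<in>B. card (nbrs N v))"
    by (subst sum.distrib) (simp add: restrict \<open>B \<subseteq> L\<close>)
  finally have "card L * k \<le> (\<Sum>v\<in>L. ?w v)"
    using sum_card_nbrs_swap[of N B] fin by simp
  also have "\<dots> = (\<Sum>x\<in>D. 2 * card (nbrs L x)) + (\<Sum>x\<in>C. card (nbrs L x))"
    using sum_card_nbrs_swap[of L D] sum_card_nbrs_swap[of L C] fin
    by (simp add: sum.distrib flip: sum_distrib_left)
  also have "\<dots> \<le> (\<Sum>x\<in>D. k - 1) + (\<Sum>x\<in>C. k - 1)"
  proof (intro add_mono sum_mono)
    fix x assume "x \<in> D"
    then show "2 * card (nbrs L x) \<le> k - 1" by (auto simp: D_def C_def)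
  next
    fix x assume "x \<in> C"
    then have "card (nbrs V x) < k" by (auto simp: C_def L_def)
    then show "card (nbrs L x) \<le> k - 1" using deg[of x] by simp
  qed
  also have "\<dots> = (card C + card D) * (k - 1)" by (simp add: algebra_simps)
  also have "\<dots> \<le> card L * (k - 1)"
  proof -
    have "card V = card L + card C + card D"
      using V_split fin by (metis card_Un_disjoint finite_UnI)
    then show ?thesis using half by (intro mult_right_mono) simp_all
  qed
  finally have "card L = 0" using \<open>k \<ge> 1\<close> by (cases k) auto
  then have "card V = 0" using half by simp
  then show False using \<open>V \<noteq> {}\<close> finite_V by simp
qed

end

section \<open>Embedding a tree with two adjacent roots\<close>

text \<open>
  The shape of a tree of diameter at most 5, seen from its central edge \<open>r1 r2\<close>: the children
  \<open>V1\<close>, \<open>V2\<close> of the two roots and the grandchildren \<open>W1\<close>, \<open>W2\<close>. All edges other than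
  \<open>r1 r2\<close> join a node to its parent. The value of \<open>par\<close> at the roots is arbitrary, which keeps
  the description symmetric under exchanging the two sides.
\<close>

locale two_rooted_tree =
  fixes r1 r2 :: 'b and V1 V2 W1 W2 :: "'b set" and par :: "'b \<Rightarrow> 'b"
  assumes finite_levels: "finite V1" "finite V2" "finite W1" "finite W2"
    and roots: "r1 \<noteq> r2" "r1 \<notin> V1 \<union> V2 \<union> W1 \<union> W2" "r2 \<notin> V1 \<union> V2 \<union> W1 \<union> W2"
    and levels_disjoint: "V1 \<inter> V2 = {}" "V1 \<inter> W1 = {}" "V1 \<inter> W2 = {}"
      "V2 \<inter> W1 = {}" "V2 \<inter> W2 = {}" "W1 \<inter> W2 = {}"
    and par_V1: "z \<in> V1 \<Longrightarrow> par z = r1" and par_V2: "z \<in> V2 \<Longrightarrow> par z = r2"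
    and par_W1: "z \<in> W1 \<Longrightarrow> par z \<in> V1" and par_W2: "z \<in> W2 \<Longrightarrow> par z \<in> V2"
begin

definition nodes :: "'b set" where
  "nodes = {r1, r2} \<union> V1 \<union> V2 \<union> W1 \<union> W2"

lemma finite_nodes: "finite nodes"
  by (simp add: nodes_def finite_levels)

lemma card_nodes: "card nodes = 2 + card V1 + card V2 + card W1 + card W2"
proof -
  have "card (V1 \<union> V2 \<union> W1 \<union> W2) = card V1 + card V2 + card W1 + card W2"
    using finite_levels levels_disjoint by (simp add: card_Un_disjoint Int_Un_distrib2)
  moreover have "nodes = insert r1 (insert r2 (V1 \<union> V2 \<union> W1 \<union> W2))"
    by (auto simp: nodes_def)
  ultimately show ?thesis using roots finite_levels by simp
qed

lemma two_rooted_tree_swap: "two_rooted_tree r2 r1 V2 V1 W2 W1 par"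
  by unfold_locales
    (use finite_levels roots levels_disjoint par_V1 par_V2 par_W1 par_W2 in \<open>simp_all add: Int_commute\<close>)

end

text \<open>
  The parent edges of distinct nodes are distinct, because \<open>par\<close> strictly decreases the level, and
  none of them is the root edge.
\<close>

lemma (in two_rooted_tree) card_nodes_le_edges:
  assumes "finite F" "{r1, r2} \<in> F" "\<And>z. z \<in> nodes - {r1, r2} \<Longrightarrow> {par z, z} \<in> F"
  shows "card nodes \<le> card F + 1"
proof -
  let ?Z = "V1 \<union> V2 \<union> W1 \<union> W2"
  have Z: "?Z = nodes - {r1, r2}" using roots unfolding nodes_def by blast
  have acyclic: "par (par z) \<noteq> z" if "z \<in> ?Z" "par z \<in> ?Z" for z
  proof -
    have "par z \<notin> {r1, r2}" using that(2) roots by blast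
    then have "z \<in> W1 \<union> W2" using that(1) par_V1 par_V2 by auto
    then have "par (par z) \<in> {r1, r2}" using par_W1 par_W2 par_V1 par_V2 by blast
    then show ?thesis using that(1) roots by auto
  qed
  have "inj_on (\<lambda>z. {par z, z}) ?Z"
  proof (rule inj_onI)
    fix x y assume xy: "x \<in> ?Z" "y \<in> ?Z" "{par x, x} = {par y, y}"
    then have "x = y \<or> (x = par y \<and> y = par x)" unfolding doubleton_eq_iff by blast
    then show "x = y" using acyclic[of x] xy(1,2) by metis
  qed
  then have "card ?Z = card ((\<lambda>z. {par z, z}) ` ?Z)" by (simp add: card_image)
  also have "\<dots> < card F"
  proof (rule psubset_card_mono[OF assms(1)])
    have "{r1, r2} \<notin> (\<lambda>z. {par z, z}) ` ?Z" using Z by blast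
    then show "(\<lambda>z. {par z, z}) ` ?Z \<subset> F" using assms(2,3) Z by blast
  qed
  finally have "card (nodes - {r1, r2}) < card F" unfolding Z .
  moreover have "card (nodes - {r1, r2}) = card nodes - 2"
    using roots(1) by (subst card_Diff_subset) (auto simp: nodes_def)
  ultimately show ?thesis by linarith
qed

locale tree_in_graph = finite_graph V E + two_rooted_tree r1 r2 V1 V2 W1 W2 par
  for V :: "'a set" and E and r1 r2 :: 'b and V1 V2 W1 W2 par +
  fixes k :: nat and L :: "'a set"
  assumes L_in_V: "L \<subseteq> V" and L_degree: "v \<in> L \<Longrightarrow> k \<le> card (nbrs V v)"
    and nodes_le: "card nodes \<le> k + 1"
begin

text \<open>
  An embedding of the subtree spanned by \<open>K\<close>, which contains the root edge and with each node its
  parent.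
\<close>

definition partial_embedding :: "'b set \<Rightarrow> ('b \<Rightarrow> 'a) \<Rightarrow> bool" where
  "partial_embedding K f \<longleftrightarrow> {r1, r2} \<subseteq> K \<and> inj_on f K \<and> f ` K \<subseteq> V \<and> E (f r1) (f r2) \<and>
     (\<forall>z\<in>K - {r1, r2}. par z \<in> K \<and> E (f (par z)) (f z))"

lemma partial_embedding_roots:
  assumes "E u v"
  obtains f where "partial_embedding {r1, r2} f" "f r1 = u" "f r2 = v"
proof
  let ?f = "\<lambda>z. if z = r1 then u else v"
  show "partial_embedding {r1, r2} ?f"
    using assms roots(1) E_irrefl E_in_V[OF assms] E_in_V[OF E_sym[OF assms]]
    by (auto simp: partial_embedding_def inj_on_def)
qed (use roots in auto)

text \<open>
  Every step of the construction has this form: a batch \<open>M\<close> of nodes whose parents are already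
  placed is placed at once, with a prescribed target set \<open>U m\<close> for each new node.
\<close>

lemma extend_embedding:
  assumes f: "partial_embedding K f"
    and M: "finite M" "K \<inter> M = {}" "\<And>m. m \<in> M \<Longrightarrow> par m \<in> K"
    and room: "\<And>m. m \<in> M \<Longrightarrow> card M \<le> card (nbrs (U m) (f (par m)) - f ` K)"
  obtains g where "partial_embedding (K \<union> M) g" "\<And>z. z \<in> K \<Longrightarrow> g z = f z"
    "\<And>m. m \<in> M \<Longrightarrow> g m \<in> U m"
proof -
  obtain h where h: "inj_on h M" "\<forall>m\<in>M. h m \<in> nbrs (U m) (f (par m)) - f ` K"
    using distinct_representatives[where N = "\<lambda>m. nbrs (U m) (f (par m))", OF M(1) finite_nbrs room]
    by blast
  define g where "g z = (if z \<in> K then f z else h z)" for z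
  have g_K: "g z = f z" if "z \<in> K" for z using that by (simp add: g_def)
  have g_M: "g z = h z" if "z \<in> M" for z using that M(2) by (auto simp: g_def)
  have im: "g ` K = f ` K" "g ` M = h ` M" using g_K g_M by auto
  have inj: "inj_on g K" "inj_on g M"
    using f h(1) g_K g_M by (auto simp: partial_embedding_def inj_on_def)
  have "h ` M \<subseteq> - f ` K" using h(2) by auto
  then have "g ` K \<inter> g ` M = {}" unfolding im by blast
  then have "inj_on g (K \<union> M)"
    using inj unfolding inj_on_Un by blast
  moreover have "h m \<in> V" if "m \<in> M" for m
    using h(2) that E_in_V[OF E_sym] by (auto simp: nbrs_def)
  ultimately have "partial_embedding (K \<union> M) g"
    using f h(2) M(3) g_K g_M unfolding partial_embedding_def nbrs_def image_Un im
    by auto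
  then show thesis
    using that g_K g_M h(2) by (auto simp: nbrs_def)
qed

text \<open>
  The reason for mapping vertices to \<open>L\<close>: once all inner vertices of the tree are placed and the
  parents of the missing leaves are in \<open>L\<close>, the leaves can be added at will, because a vertex of
  degree at least \<open>k\<close> cannot run out of free neighbours while at most \<open>k + 1\<close> nodes are placed.
\<close>

lemma attach_leaves:
  assumes f: "partial_embedding K f" and "K \<subseteq> nodes"
    and leaves: "\<And>z. z \<in> nodes - K \<Longrightarrow> par z \<in> K \<and> f (par z) \<in> L"
  shows "\<exists>g. partial_embedding nodes g"
proof -
  have fin: "finite K" using assms(2) finite_nodes finite_subset by blast
  have room: "card (nodes - K) \<le> card (nbrs V (f (par m)) - f ` K)" if m: "m \<in> nodes - K" for m
  proof (rule card_nbrs_Diff_ge)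
    let ?v = "f (par m)"
    have v: "?v \<in> f ` K" "k \<le> card (nbrs V ?v)" using leaves[OF m] L_degree by auto
    have "card (f ` K \<inter> V - {?v}) \<le> card (f ` K - {?v})"
      using fin by (intro card_mono) auto
    also have "\<dots> = card (f ` K) - 1" using v(1) fin by simp
    also have "\<dots> = card K - 1"
      using f by (simp add: partial_embedding_def card_image)
    finally have "card (f ` K \<inter> V - {?v}) \<le> card K - 1" .
    moreover have "card (nodes - K) = card nodes - card K"
      using assms(2) fin by (simp add: card_Diff_subset)
    moreover have "card K > 0" using fin leaves[OF m] by (auto simp: card_gt_0_iff)
    moreover have "card K \<le> card nodes" using assms(2) finite_nodes by (rule card_mono[rotated])
    ultimately show "card (f ` K \<inter> V - {?v}) + card (nodes - K) \<le> card (nbrs V ?v)"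
      using v(2) nodes_le by linarith
  qed (use fin in simp)
  obtain g where "partial_embedding (K \<union> (nodes - K)) g"
  proof (rule extend_embedding[where M = "nodes - K" and U = "\<lambda>_. V", OF f _ _ _ room])
    show "finite (nodes - K)" using finite_nodes by simp
    show "par m \<in> K" if "m \<in> nodes - K" for m using leaves[OF that] by simp
  qed auto
  moreover have "K \<union> (nodes - K) = nodes" using assms(2) by auto
  ultimately show ?thesis by metis
qed

text \<open>
  The inner vertices of the tree are the roots and the vertices in \<open>par ` W1\<close> and \<open>par ` W2\<close>,
  and here all of them are mapped to \<open>L\<close>. As \<open>v\<close> may have few neighbours in \<open>L\<close>, the
  children of its root are placed first; \<open>u\<close> has room for the children on both sides.
\<close>

lemma embedding_if_inner_in_L:
  assumes "E v u" "v \<in> L" "u \<in> L"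
    and v: "card (par ` W1) < card (nbrs L v)"
    and u: "card (par ` W1) + card (par ` W2) < card (nbrs L u)"
  shows "\<exists>f. partial_embedding nodes f"
proof -
  let ?I1 = "par ` W1" and ?I2 = "par ` W2"
  have I: "?I1 \<subseteq> V1" "?I2 \<subseteq> V2" using par_W1 par_W2 by auto
  have fin: "finite ?I1" "finite ?I2" using finite_levels by auto
  obtain f where f: "partial_embedding {r1, r2} f" "f r1 = v" "f r2 = u"
    using partial_embedding_roots[OF \<open>E v u\<close>] by blast
  have "card ?I1 \<le> card (nbrs L (f (par m)) - f ` {r1, r2})" if "m \<in> ?I1" for m
  proof -
    have "card (f ` {r1, r2} \<inter> L - {v}) \<le> card {u}"
      by (rule card_mono) (use f in auto)
    then show ?thesis using that I par_V1 f v by (intro card_nbrs_Diff_ge) auto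
  qed
  moreover have "{r1, r2} \<inter> ?I1 = {}" "\<And>m. m \<in> ?I1 \<Longrightarrow> par m \<in> {r1, r2}"
    using I roots par_V1 by auto
  ultimately obtain g where g0: "partial_embedding ({r1, r2} \<union> ?I1) g"
      "\<And>z. z \<in> {r1, r2} \<Longrightarrow> g z = f z" "\<And>m. m \<in> ?I1 \<Longrightarrow> g m \<in> L"
    using extend_embedding[OF f(1) fin(1), of "\<lambda>_. L"] by blast
  then have g: "partial_embedding ({r1, r2} \<union> ?I1) g" "g r1 = v" "g r2 = u"
      "\<And>m. m \<in> ?I1 \<Longrightarrow> g m \<in> L"
    using f by auto
  have "card ?I2 \<le> card (nbrs L (g (par m)) - g ` ({r1, r2} \<union> ?I1))" if "m \<in> ?I2" for m
  proof -
    have "card (g ` ({r1, r2} \<union> ?I1) \<inter> L - {u}) \<le> card (insert v (g ` ?I1))"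
      by (rule card_mono) (use g fin in auto)
    also have "\<dots> \<le> Suc (card (g ` ?I1))" using fin by (simp add: card_insert_if)
    also have "\<dots> \<le> Suc (card ?I1)" using card_image_le[OF fin(1)] by simp
    finally show ?thesis using that I par_V2 g u fin by (intro card_nbrs_Diff_ge) auto
  qed
  moreover have "({r1, r2} \<union> ?I1) \<inter> ?I2 = {}" using I roots levels_disjoint by auto
  moreover have "par m \<in> {r1, r2} \<union> ?I1" if "m \<in> ?I2" for m using that I par_V2 by auto
  ultimately obtain h where h: "partial_embedding ({r1, r2} \<union> ?I1 \<union> ?I2) h"
      "\<And>z. z \<in> {r1, r2} \<union> ?I1 \<Longrightarrow> h z = g z" "\<And>m. m \<in> ?I2 \<Longrightarrow> h m \<in> L"
    using extend_embedding[OF g(1), of ?I2 "\<lambda>_. L"] fin by blast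
  have core: "h z \<in> L" if "z \<in> {r1, r2} \<union> ?I1 \<union> ?I2" for z
    using that h(2)[of z] h(3) g \<open>v \<in> L\<close> \<open>u \<in> L\<close> by auto
  show ?thesis
  proof (rule attach_leaves[OF h(1)])
    show "{r1, r2} \<union> ?I1 \<union> ?I2 \<subseteq> nodes" using I by (auto simp: nodes_def)
    fix z assume "z \<in> nodes - ({r1, r2} \<union> ?I1 \<union> ?I2)"
    then have "par z \<in> {r1, r2} \<union> ?I1 \<union> ?I2"
      using par_V1 par_V2 by (auto simp: nodes_def)
    then show "par z \<in> {r1, r2} \<union> ?I1 \<union> ?I2 \<and> h (par z) \<in> L" using core by blast
  qed
qed

text \<open>
  Now \<open>r2\<close> is mapped outside \<open>L\<close>, so all its children, leaves or not, go to \<open>L\<close>. The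
  non-leaf children of \<open>r1\<close> go to \<open>L \<union> C\<close>. Those that end in \<open>C\<close> may have degree less than
  \<open>k\<close>, so their children are placed, inside \<open>L\<close>, before the remaining leaves. There is room: the
  vertices of \<open>L\<close> used so far are \<open>v\<close>, the images of \<open>V2\<close>, and the images in \<open>L\<close> of non-leaf
  children of \<open>r1\<close>; and each of the latter has a child in \<open>W1\<close> that is not yet to be placed, so
  that altogether at most \<open>1 + |V2| + |W1|\<close> vertices of \<open>L\<close> are needed up to this point.
\<close>

lemma embedding_if_root_in_C:
  assumes "E v u" "v \<in> L" "u \<in> C" "L \<inter> C = {}"
    and C: "\<And>c. c \<in> C \<Longrightarrow> card V2 + card W1 < card (nbrs L c)"
    and v: "card V2 + card W1 < card (nbrs (L \<union> C) v)"
  shows "\<exists>f. partial_embedding nodes f"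
proof -
  let ?I = "par ` W1"
  let ?K = "{r1, r2} \<union> (?I \<union> V2)"
  let ?U = "\<lambda>z. if z \<in> V2 then L else L \<union> C"
  have I: "?I \<subseteq> V1" using par_W1 by auto
  have fin: "finite ?I" "finite (?I \<union> V2)" using finite_levels by auto
  obtain f where f: "partial_embedding {r1, r2} f" "f r1 = v" "f r2 = u"
    using partial_embedding_roots[OF \<open>E v u\<close>] by blast
  have card_IV2: "card (?I \<union> V2) \<le> card V2 + card W1"
    using card_Un_le[of ?I V2] card_image_le[of W1 par] finite_levels by linarith
  have room: "card (?I \<union> V2) \<le> card (nbrs (?U m) (f (par m)) - f ` {r1, r2})"
    if m: "m \<in> ?I \<union> V2" for m
  proof (cases "m \<in> V2")
    case True
    have "card (f ` {r1, r2} \<inter> L - {u}) \<le> card {v}"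
      by (rule card_mono) (use f in auto)
    then have "card (?I \<union> V2) \<le> card (nbrs L u - f ` {r1, r2})"
      using C[OF \<open>u \<in> C\<close>] card_IV2 by (intro card_nbrs_Diff_ge) auto
    then show ?thesis using True par_V2 f by simp
  next
    case False
    have "card (f ` {r1, r2} \<inter> (L \<union> C) - {v}) \<le> card {u}"
      by (rule card_mono) (use f in auto)
    then have "card (?I \<union> V2) \<le> card (nbrs (L \<union> C) v - f ` {r1, r2})"
      using v card_IV2 by (intro card_nbrs_Diff_ge) auto
    moreover have "par m = r1" using m False I par_V1 by auto
    ultimately show ?thesis using False f by simp
  qed
  have "{r1, r2} \<inter> (?I \<union> V2) = {}" using I roots by auto
  moreover have "par m \<in> {r1, r2}" if "m \<in> ?I \<union> V2" for m using that I par_V1 par_V2 by auto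
  ultimately obtain g where g: "partial_embedding ?K g"
      "\<And>z. z \<in> {r1, r2} \<Longrightarrow> g z = f z" "\<And>m. m \<in> ?I \<union> V2 \<Longrightarrow> g m \<in> ?U m"
    using extend_embedding[OF f(1) fin(2) _ _ room] by blast
  have g_roots: "g r1 = v" "g r2 = u" using g(2) f by auto
  have g_V2: "g z \<in> L" if "z \<in> V2" for z using g(3)[of z] that by simp
  have g_I: "g z \<in> L \<union> C" if "z \<in> ?I" for z
    using g(3)[of z] that I levels_disjoint by (auto split: if_splits)
  (* The children whose parent has been placed in C; they cannot be left to the end. *)
  define Wc where "Wc = {w \<in> W1. g (par w) \<in> C}"
  have Wc: "Wc \<subseteq> W1" "finite Wc" using finite_levels by (auto simp: Wc_def)
  have roomc: "card Wc \<le> card (nbrs L (g (par m)) - g ` ?K)" if m: "m \<in> Wc" for m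
  proof (rule card_nbrs_Diff_ge)
    have sub: "g ` ?K \<inter> L \<subseteq> insert v (g ` V2 \<union> g ` par ` (W1 - Wc))"
    proof
      fix y assume "y \<in> g ` ?K \<inter> L"
      then obtain z where z: "z \<in> ?K" "y = g z" "g z \<in> L" by blast
      have "g z \<notin> C" using z(3) \<open>L \<inter> C = {}\<close> by blast
      then have "z \<noteq> r2" using g_roots \<open>u \<in> C\<close> by auto
      then consider "z = r1" | "z \<in> V2" | w where "w \<in> W1" "z = par w" using z(1) by blast
      then show "y \<in> insert v (g ` V2 \<union> g ` par ` (W1 - Wc))"
      proof cases
        case 3
        then have "w \<in> W1 - Wc" using \<open>g z \<notin> C\<close> by (simp add: Wc_def)
        then show ?thesis using 3 z(2) by blast
      qed (use z g_roots in simp_all)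
    qed
    have "card (g ` ?K \<inter> L - {g (par m)}) \<le> card (insert v (g ` V2 \<union> g ` par ` (W1 - Wc)))"
      by (rule card_mono) (use sub finite_levels in auto)
    also have "\<dots> \<le> Suc (card (g ` V2 \<union> g ` par ` (W1 - Wc)))"
      using finite_levels by (simp add: card_insert_if)
    finally have total: "card (g ` ?K \<inter> L - {g (par m)})
        \<le> Suc (card (g ` V2 \<union> g ` par ` (W1 - Wc)))" .
    have "card (g ` V2 \<union> g ` par ` (W1 - Wc)) \<le> card (g ` V2) + card (g ` par ` (W1 - Wc))"
      by (rule card_Un_le)
    also have "\<dots> \<le> card V2 + card (W1 - Wc)"
      unfolding image_image using finite_levels by (intro add_mono card_image_le) auto
    also have "card (W1 - Wc) = card W1 - card Wc" using Wc by (simp add: card_Diff_subset)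
    finally have "card (g ` V2 \<union> g ` par ` (W1 - Wc)) \<le> card V2 + (card W1 - card Wc)" .
    moreover have "card Wc \<le> card W1" using Wc finite_levels by (intro card_mono) auto
    moreover have "card V2 + card W1 < card (nbrs L (g (par m)))" using m C by (auto simp: Wc_def)
    ultimately show "card (g ` ?K \<inter> L - {g (par m)}) + card Wc \<le> card (nbrs L (g (par m)))"
      using total by linarith
  qed (use fin in simp)
  have "?K \<inter> Wc = {}" using Wc I roots levels_disjoint by auto
  moreover have "par m \<in> ?K" if "m \<in> Wc" for m using that Wc by auto
  ultimately obtain h where h: "partial_embedding (?K \<union> Wc) h" "\<And>z. z \<in> ?K \<Longrightarrow> h z = g z"
    by (rule extend_embedding[where U = "\<lambda>_. L", OF g(1) Wc(2) _ _ roomc]) blast+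
  show ?thesis
  proof (rule attach_leaves[OF h(1)])
    show "?K \<union> Wc \<subseteq> nodes" using I Wc by (auto simp: nodes_def)
    fix z assume z: "z \<in> nodes - (?K \<union> Wc)"
    then consider "z \<in> V1" | "z \<in> W1 - Wc" | "z \<in> W2" by (auto simp: nodes_def)
    then have "par z \<in> ?K \<and> g (par z) \<in> L"
    proof cases
      case 1
      then show ?thesis using par_V1 g_roots \<open>v \<in> L\<close> by simp
    next
      case 2
      then show ?thesis using g_I[of "par z"] by (auto simp: Wc_def)
    next
      case 3
      then show ?thesis using par_W2 g_V2 by simp
    qed
    then show "par z \<in> ?K \<union> Wc \<and> h (par z) \<in> L" using h(2) by auto
  qed
qed

lemma tree_in_graph_swap: "tree_in_graph V E r2 r1 V2 V1 W2 W1 par k L"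
proof -
  interpret sw: two_rooted_tree r2 r1 V2 V1 W2 W1 par by (rule two_rooted_tree_swap)
  have "card sw.nodes \<le> k + 1" using nodes_le card_nodes sw.card_nodes by simp
  then show ?thesis using L_in_V L_degree by unfold_locales auto
qed

lemma swapped_embedding:
  assumes "tree_in_graph.partial_embedding V E r2 r1 par (two_rooted_tree.nodes r2 r1 V2 V1 W2 W1) f"
  shows "partial_embedding nodes f"
proof -
  interpret sw: tree_in_graph V E r2 r1 V2 V1 W2 W1 par k L by (rule tree_in_graph_swap)
  have "sw.nodes = nodes" by (auto simp: nodes_def sw.nodes_def)
  then show ?thesis using assms E_sym
    unfolding partial_embedding_def sw.partial_embedding_def by (auto simp: insert_commute)
qed

text \<open>
  The bound on \<open>|V2| + |W1|\<close> also bounds the number of non-leaf children of the roots, since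
  \<open>par\<close> maps \<open>W1\<close> onto those of \<open>r1\<close>. So fewer than \<open>k/2\<close> of them exist in total, fewer
  than \<open>k/4\<close> at one of the roots, and for an edge inside \<open>L\<close> that root is mapped to the
  end that is only known to have \<open>k/4\<close> neighbours in \<open>L\<close>.
\<close>

lemma embedding_if_light_side:
  assumes "1 \<le> k" "V \<noteq> {}"
    and L: "L = {v \<in> V. k \<le> card (nbrs V v)}" "card V \<le> 2 * card L"
    and light: "2 * (card V2 + card W1) < k"
  shows "\<exists>f. partial_embedding nodes f"
proof -
  interpret sw: tree_in_graph V E r2 r1 V2 V1 W2 W1 par k L by (rule tree_in_graph_swap)
  have light': "2 * card V2 + 2 * card W1 < k" using light by simp
  define C where "C = {x \<in> V - L. k \<le> 2 * card (nbrs L x)}"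
  have C: "k \<le> 2 * card (nbrs L c)" if "c \<in> C" for c using that by (simp add: C_def)
  have inner: "card (par ` W1) + card (par ` W2) \<le> card V2 + card W1"
  proof (subst add.commute, rule add_mono)
    show "card (par ` W2) \<le> card V2" by (rule card_mono) (use finite_levels par_W2 in auto)
    show "card (par ` W1) \<le> card W1" by (rule card_image_le) (rule finite_levels)
  qed
  obtain u v where "E u v" "v \<in> L"
    and uv: "u \<in> L \<and> k \<le> 2 * card (nbrs L u) \<and> k \<le> 4 * card (nbrs L v)
       \<or> u \<in> C \<and> k \<le> 2 * card (nbrs (L \<union> C) v)"
    using exists_dense_edge[OF assms(1,2) L(1) C_def L(2)] by blast
  from E_sym[OF \<open>E u v\<close>] have vu: "E v u" .
  show ?thesis
    using uv
  proof (elim disjE conjE)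
    assume u: "u \<in> L" "k \<le> 2 * card (nbrs L u)" and v: "k \<le> 4 * card (nbrs L v)"
    have u': "card (par ` W1) + card (par ` W2) < card (nbrs L u)"
      using u inner light' by linarith
    show ?thesis
    proof (cases "card (par ` W1) \<le> card (par ` W2)")
      case True
      then have "card (par ` W1) < card (nbrs L v)" using v inner light' by linarith
      then show ?thesis using embedding_if_inner_in_L[OF vu \<open>v \<in> L\<close> u(1)] u' by blast
    next
      case False
      then have "card (par ` W2) < card (nbrs L v)" using v inner light' by linarith
      moreover have "card (par ` W2) + card (par ` W1) < card (nbrs L u)" using u' by simp
      ultimately obtain f where "sw.partial_embedding sw.nodes f"
        using sw.embedding_if_inner_in_L[OF vu \<open>v \<in> L\<close> u(1)] by blast
      then show ?thesis using swapped_embedding by blast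
    qed
  next
    assume "u \<in> C" and v: "k \<le> 2 * card (nbrs (L \<union> C) v)"
    show ?thesis
    proof (rule embedding_if_root_in_C[OF vu \<open>v \<in> L\<close> \<open>u \<in> C\<close>])
      show "L \<inter> C = {}" by (auto simp: C_def)
      show "card V2 + card W1 < card (nbrs L c)" if "c \<in> C" for c
        using C[OF that] light' by linarith
      show "card V2 + card W1 < card (nbrs (L \<union> C) v)" using v light' by linarith
    qed
  qed
qed

text \<open>
  The four levels have at most \<open>k - 1\<close> nodes together, so \<open>V2 \<union> W1\<close> or \<open>V1 \<union> W2\<close> has
  fewer than \<open>k/2\<close> of them; exchanging the roots covers the second case.
\<close>

lemma exists_embedding:
  assumes "1 \<le> k" "V \<noteq> {}"
    and L: "L = {v \<in> V. k \<le> card (nbrs V v)}" "card V \<le> 2 * card L"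
  shows "\<exists>f. partial_embedding nodes f"
proof (cases "2 * (card V2 + card W1) < k")
  case True
  then show ?thesis by (rule embedding_if_light_side[OF assms])
next
  case False
  interpret sw: tree_in_graph V E r2 r1 V2 V1 W2 W1 par k L by (rule tree_in_graph_swap)
  have "k \<le> 2 * card V2 + 2 * card W1" using False by simp
  then have "2 * (card V1 + card W2) < k"
    using nodes_le card_nodes unfolding distrib_left by linarith
  then obtain f where "sw.partial_embedding sw.nodes f"
    using sw.embedding_if_light_side[OF assms] by blast
  then show ?thesis using swapped_embedding by blast
qed

end

section \<open>The central edge of a tree of diameter at most 5\<close>

text \<open>
  Trees described through vertex lists: \<open>acyclic\<close> excludes closed paths with at least three
  vertices, and \<open>short_path\<close> contains connectedness as well as the bound on the diameter (a path of
  length 5 has 6 vertices).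
\<close>

locale tree_diameter_5 =
  fixes V :: "'b set" and E :: "'b \<Rightarrow> 'b \<Rightarrow> bool"
  assumes finite_V: "finite V"
    and E_in_V: "E x y \<Longrightarrow> x \<in> V"
    and E_sym: "E x y \<Longrightarrow> E y x"
    and E_irrefl: "\<not> E x x"
    and acyclic: "distinct xs \<Longrightarrow> successively E xs \<Longrightarrow> 3 \<le> length xs \<Longrightarrow> \<not> E (last xs) (hd xs)"
    and short_path: "x \<in> V \<Longrightarrow> y \<in> V \<Longrightarrow>
      \<exists>xs. distinct xs \<and> successively E xs \<and> xs \<noteq> [] \<and> hd xs = x \<and> last xs = y \<and> length xs \<le> 6"
begin

abbreviation path :: "'b list \<Rightarrow> bool" where
  "path xs \<equiv> distinct xs \<and> successively E xs"

lemma E_in_V': "E x y \<Longrightarrow> y \<in> V"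
  using E_in_V E_sym by blast

lemma successively_E_rev: "successively E (rev xs) = successively E xs"
proof -
  have "(\<lambda>x y. E y x) = E" by (intro ext) (blast intro: E_sym)
  then show ?thesis by (simp only: successively_rev)
qed

lemma no_triangle: "E a b \<Longrightarrow> E b c \<Longrightarrow> \<not> E c a"
  using acyclic[of "[a, b, c]"] E_irrefl by auto

lemma no_4_cycle: "E a b \<Longrightarrow> E b c \<Longrightarrow> E c d \<Longrightarrow> a \<noteq> c \<Longrightarrow> b \<noteq> d \<Longrightarrow> \<not> E d a"
  using acyclic[of "[a, b, c, d]"] E_irrefl by auto

text \<open>
  A closed walk of length 5 that repeats a vertex contains a triangle, so distinctness is automatic.
\<close>

lemma no_5_cycle: "E a b \<Longrightarrow> E b c \<Longrightarrow> E c d \<Longrightarrow> E d e \<Longrightarrow> \<not> E e a"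
proof
  assume E: "E a b" "E b c" "E c d" "E d e" "E e a"
  have "a \<noteq> b" "b \<noteq> c" "c \<noteq> d" "d \<noteq> e" "e \<noteq> a" using E E_irrefl by blast+
  moreover have "a \<noteq> c" "b \<noteq> d" "c \<noteq> e" "d \<noteq> a" "e \<noteq> b" using E no_triangle by blast+
  ultimately show False using acyclic[of "[a, b, c, d, e]"] E by simp
qed

text \<open>
  Following \<open>p\<close> from \<open>a\<close> to the first vertex \<open>y\<close> that lies on \<open>q\<close>, and going back along
  \<open>q\<close>, would give a cycle.
\<close>

lemma diverging_paths_disjoint:
  assumes "path (a # p)" "path (a # q)" "p \<noteq> []" "q \<noteq> []" "hd p \<noteq> hd q"
  shows "set p \<inter> set q = {}"
proof (rule ccontr)
  assume "set p \<inter> set q \<noteq> {}"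
  then have "\<exists>x\<in>set p. x \<in> set q" by auto
  then obtain p1 y p2 where p: "p = p1 @ y # p2" "y \<in> set q" "\<forall>x\<in>set p1. x \<notin> set q"
    using split_list_first_prop[of p "\<lambda>x. x \<in> set q"] by blast
  obtain q1 q2 where q: "q = q1 @ y # q2" using p(2) by (meson split_list)
  let ?c = "a # p1 @ y # rev q1"
  have "distinct ?c" using assms(1,2) p q by auto
  have p1: "successively E ((a # p1) @ [y])"
    using assms(1) p(1) successively_append_iff[of E "a # p1" "y # p2"]
      successively_append_iff[of E "a # p1" "[y]"] by simp
  have "successively E ((a # q1) @ [y])"
    using assms(2) q successively_append_iff[of E "a # q1" "y # q2"]
      successively_append_iff[of E "a # q1" "[y]"] by simp
  then have "successively E ((y # rev q1) @ [a])"
    using successively_E_rev[of "(a # q1) @ [y]"] by simp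
  then have q1: "successively E (y # rev q1)" "E (last (y # rev q1)) a"
    using successively_append_iff[of E "y # rev q1" "[a]"] by simp_all
  have "successively E ?c"
    using p1 q1(1) successively_append_iff[of E "a # p1" "y # rev q1"]
      successively_append_iff[of E "a # p1" "[y]"] by simp
  moreover have "3 \<le> length ?c"
    using assms(5) p(1) q by (cases p1; cases q1) simp_all
  moreover have "E (last ?c) (hd ?c)" using q1(2) by simp
  ultimately show False using acyclic \<open>distinct ?c\<close> by blast
qed

lemma path_unique:
  assumes "path (a # p)" "path (a # q)" "last (a # p) = last (a # q)"
  shows "p = q"
  using assms
proof (induction p arbitrary: a q)
  case Nil
  then show ?case by (metis distinct.simps(2) last.simps last_in_set)
next
  case (Cons b p)
  then have "q \<noteq> []" by (metis distinct.simps(2) last.simps last_in_set list.distinct(1))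
  then have "last (b # p) \<in> set (b # p) \<inter> set q"
    using Cons.prems(3) by (metis IntI last.simps last_in_set list.distinct(1))
  then have hd: "hd q = b"
    using diverging_paths_disjoint[OF Cons.prems(1,2)] \<open>q \<noteq> []\<close>
    by (metis empty_iff list.distinct(1) list.sel(1))
  then obtain q' where q: "q = b # q'" using \<open>q \<noteq> []\<close> by (cases q) auto
  show ?case using Cons.IH[of b q'] Cons.prems q by auto
qed

lemma path_ends_in_V: "successively E xs \<Longrightarrow> 2 \<le> length xs \<Longrightarrow> hd xs \<in> V \<and> last xs \<in> V"
proof -
  assume s: "successively E xs" "2 \<le> length xs"
  then obtain a b ys where xs: "xs = a # b # ys" by (cases xs; cases "tl xs") auto
  have "\<exists>x. E x (last (b # ys))" using s(1) unfolding xs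
    by (induction ys arbitrary: a b) auto
  then show ?thesis using s(1) xs E_in_V E_in_V' by auto
qed

text \<open>
Paths are unique, so every path is as short as a shortest one between its ends.
\<close>

lemma path_length_le: "path xs \<Longrightarrow> length xs \<le> 6"
proof (cases "2 \<le> length xs")
  case True
  assume p: "path xs"
  obtain ys where ys: "path ys" "ys \<noteq> []" "hd ys = hd xs" "last ys = last xs" "length ys \<le> 6"
    using short_path path_ends_in_V[of xs] p True by metis
  obtain a xs' ys' where "xs = a # xs'" "ys = a # ys'"
    using ys(2,3) True by (cases xs; cases ys) auto
  then have "ys = xs" using path_unique[of a ys' xs'] p ys by auto
  then show ?thesis using ys by simp
qed simp

text \<open>
  The middle edge \<open>r1 r2\<close> of a longest path \<open>p\<close>. A path that leaves \<open>r1\<close> away from \<open>r2\<close> is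
  disjoint from the part of \<open>p\<close> beyond \<open>r1\<close>, so the two can be joined, and maximality of \<open>p\<close>
  bounds its length by that of the part of \<open>p\<close> before \<open>r1\<close>, which has at most two edges.
\<close>

lemma exists_central_edge:
  assumes "E a b"
  obtains r1 r2 where "E r1 r2"
    "\<And>q. path (r1 # q) \<Longrightarrow> q \<noteq> [] \<Longrightarrow> hd q \<noteq> r2 \<Longrightarrow> length q \<le> 2"
    "\<And>q. path (r2 # q) \<Longrightarrow> q \<noteq> [] \<Longrightarrow> hd q \<noteq> r1 \<Longrightarrow> length q \<le> 2"
proof -
  have ab: "path [a, b]" using assms E_irrefl by auto
  obtain p where p: "path p" and longest: "\<And>q. path q \<Longrightarrow> length q \<le> length p"
  proof -
    have "\<exists>p. path p \<and> (\<forall>q. path q \<longrightarrow> length q \<le> length p)"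
    proof (rule ex_has_greatest_nat[of path "[a, b]" length 7])
      show "\<forall>q. path q \<longrightarrow> length q < 7"
        using path_length_le by (simp add: less_eq_Suc_le eval_nat_numeral)
    qed (rule ab)
    then show thesis using that by blast
  qed
  have len: "2 \<le> length p" "length p \<le> 6"
    using longest[OF ab] path_length_le[OF p] by auto
  define j where "j = length p div 2 - 1"
  define p1 where "p1 = take j p"
  have "length (drop j p) \<ge> 2" using len by (simp add: j_def)
  then obtain r1 r2 p2 where "drop j p = r1 # r2 # p2"
    by (metis One_nat_def Suc_1 Suc_le_length_iff)
  then have p_eq: "p = p1 @ r1 # r2 # p2" by (metis append_take_drop_id p1_def)
  have p1: "length p1 = j" using len by (simp add: p1_def j_def)
  have "length p = j + 2 + length p2" using p_eq p1 by simp
  then have short: "length p1 \<le> 2" "length p2 \<le> 2" using len p1 by (auto simp: j_def)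
  have fwd: "path (r1 # r2 # p2)"
    using p successively_append_iff[of E p1 "r1 # r2 # p2"] unfolding p_eq by simp
  have "path (rev p)" using p successively_E_rev by simp
  then have bwd: "path (r2 # r1 # rev p1)"
    using successively_append_iff[of E "rev p2" "r2 # r1 # rev p1"] unfolding p_eq by simp
  have branch: "length q + length t \<le> length p"
    if "path (r # q)" "path (r # s # t')" "q \<noteq> []" "hd q \<noteq> s" "t = r # s # t'" for r s q t t'
  proof -
    have "set q \<inter> set (s # t') = {}"
      using diverging_paths_disjoint[OF that(1,2,3)] that(4) by simp
    moreover have "successively E (rev q @ r # s # t')"
    proof -
      have "successively E q" "E r (hd q)"
        using that(1,3) by (simp_all add: successively_Cons)
      moreover have "last (rev q) = hd q" using that(3) by (simp add: last_rev)
      ultimately show ?thesis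
        using that(2) successively_E_rev[of q] E_sym[of r "hd q"]
        unfolding successively_append_iff by simp
    qed
    ultimately have "path (rev q @ r # s # t')" using that(1,2) by auto
    from longest[OF this] show ?thesis using that(5) by simp
  qed
  show thesis
  proof
    show "E r1 r2" using fwd by simp
    show "length q \<le> 2" if "path (r1 # q)" "q \<noteq> []" "hd q \<noteq> r2" for q
      using branch[OF that(1) fwd that(2,3)] p_eq short by simp
    show "length q \<le> 2" if "path (r2 # q)" "q \<noteq> []" "hd q \<noteq> r1" for q
      using branch[OF that(1) bwd that(2,3)] p_eq short by simp
  qed
qed

lemma path_list_le_2:
  "path (r # q) \<Longrightarrow> length q \<le> 2 \<Longrightarrow>
     q = [] \<or> (\<exists>v. q = [v] \<and> E r v) \<or> (\<exists>v w. q = [v, w] \<and> E r v \<and> E v w \<and> w \<noteq> r)"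
  by (cases q; cases "tl q") auto

text \<open>
  Every vertex lies on a path from \<open>r1\<close>, which continues from \<open>r1\<close> or from \<open>r2\<close> by at most
  two more edges, so the levels cover the tree. Any coincidence between levels, and any second parent
  of a grandchild, would close a cycle of length at most 5; an edge from a grandchild to anything but
  its parent would continue a path from its root to a third edge.
\<close>

lemma exists_two_rooted_structure:
  assumes "E a b"
  obtains r1 r2 V1 V2 W1 W2 par
  where "two_rooted_tree r1 r2 V1 V2 W1 W2 par"
    and "V = two_rooted_tree.nodes r1 r2 V1 V2 W1 W2"
    and "E r1 r2" "\<And>z. z \<in> V - {r1, r2} \<Longrightarrow> E (par z) z"
    and "\<And>x y. E x y \<Longrightarrow> {x, y} = {r1, r2} \<or> x \<notin> {r1, r2} \<and> y = par x \<or> y \<notin> {r1, r2} \<and> x = par y"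
proof -
  obtain r1 r2 where r: "E r1 r2"
    and far1: "\<And>q. path (r1 # q) \<Longrightarrow> q \<noteq> [] \<Longrightarrow> hd q \<noteq> r2 \<Longrightarrow> length q \<le> 2"
    and far2: "\<And>q. path (r2 # q) \<Longrightarrow> q \<noteq> [] \<Longrightarrow> hd q \<noteq> r1 \<Longrightarrow> length q \<le> 2"
    using exists_central_edge[OF assms] by blast
  have r': "E r2 r1" "r1 \<noteq> r2" using r E_sym E_irrefl by auto
  define V1 where "V1 = {v. E r1 v \<and> v \<noteq> r2}"
  define V2 where "V2 = {v. E r2 v \<and> v \<noteq> r1}"
  define W1 where "W1 = {w. w \<noteq> r1 \<and> (\<exists>v\<in>V1. E v w)}"
  define W2 where "W2 = {w. w \<noteq> r2 \<and> (\<exists>v\<in>V2. E v w)}"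
  define par where
    "par z = (if z \<in> V1 then r1 else if z \<in> V2 then r2 else SOME v. v \<in> V1 \<union> V2 \<and> E v z)" for z
  have V1: "E r1 v" "E v r1" "v \<noteq> r2" "v \<noteq> r1" if "v \<in> V1" for v
    using that E_sym[of r1 v] E_irrefl by (auto simp: V1_def)
  have V2: "E r2 v" "E v r2" "v \<noteq> r1" "v \<noteq> r2" if "v \<in> V2" for v
    using that E_sym[of r2 v] E_irrefl by (auto simp: V2_def)
  have W1: "\<exists>v\<in>V1. E v w \<and> E w v \<and> w \<noteq> r1" if "w \<in> W1" for w
    using that E_sym[of _ w] unfolding W1_def by blast
  have W2: "\<exists>v\<in>V2. E v w \<and> E w v \<and> w \<noteq> r2" if "w \<in> W2" for w
    using that E_sym[of _ w] unfolding W2_def by blast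
  have dis: "V1 \<inter> V2 = {}" "V1 \<inter> W1 = {}" "V1 \<inter> W2 = {}" "V2 \<inter> W1 = {}" "V2 \<inter> W2 = {}"
      "W1 \<inter> W2 = {}" "r1 \<notin> W1" "r2 \<notin> W1" "r1 \<notin> W2" "r2 \<notin> W2"
  proof -
    show "V1 \<inter> V2 = {}" using V1(1) V2(2) no_triangle[of r1 _ r2] r' by blast
    show "V1 \<inter> W1 = {}" using V1 W1 no_triangle[of r1] by blast
    show "V2 \<inter> W2 = {}" using V2 W2 no_triangle[of r2] by blast
    show "V1 \<inter> W2 = {}" using V1(1,3) V2(2,3) W2 no_4_cycle[of r1 _ _ r2] r' by blast
    show "V2 \<inter> W1 = {}" using V2(1,3) V1(2,3) W1 no_4_cycle[of r2 _ _ r1] r by blast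
    show "W1 \<inter> W2 = {}" using V1(1) V2(2) W1 W2 no_5_cycle[of r1 _ _ _ r2] r' by blast
    show "r2 \<notin> W1" using V1(1) W1 no_triangle[of r1 _ r2] r' by blast
    show "r1 \<notin> W2" using V2(1) W2 no_triangle[of r2 _ r1] r by blast
  qed (use W1 W2 in blast)+
  have rV: "r1 \<notin> V1" "r1 \<notin> V2" "r2 \<notin> V1" "r2 \<notin> V2"
    using E_irrefl by (auto simp: V1_def V2_def)
  have par_eq1: "par w = v" if "v \<in> V1" "E v w" "w \<noteq> r1" for v w
  proof -
    have w: "w \<in> W1" using that by (auto simp: W1_def)
    have "(SOME v. v \<in> V1 \<union> V2 \<and> E v w) = v"
    proof (rule some_equality)
      fix v' assume v': "v' \<in> V1 \<union> V2 \<and> E v' w"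
      have "w \<notin> W2" "w \<noteq> r2" using w dis by auto
      then have "v' \<in> V1" using v' by (auto simp: W2_def)
      then show "v' = v"
        using no_4_cycle[of r1 v w v'] that v' E_sym by (auto simp: V1_def)
    qed (use that in simp)
    then show ?thesis using w dis by (auto simp: par_def)
  qed
  have par_eq2: "par w = v" if "v \<in> V2" "E v w" "w \<noteq> r2" for v w
  proof -
    have w: "w \<in> W2" using that by (auto simp: W2_def)
    have "(SOME v. v \<in> V1 \<union> V2 \<and> E v w) = v"
    proof (rule some_equality)
      fix v' assume v': "v' \<in> V1 \<union> V2 \<and> E v' w"
      have "w \<notin> W1" "w \<noteq> r1" using w dis by auto
      then have "v' \<in> V2" using v' by (auto simp: W1_def)
      then show "v' = v"
        using no_4_cycle[of r2 v w v'] that v' E_sym by (auto simp: V2_def)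
    qed (use that in simp)
    then show ?thesis using w dis by (auto simp: par_def)
  qed
  have par_V: "par z = r1" if "z \<in> V1" for z using that by (simp add: par_def)
  have par_V': "par z = r2" if "z \<in> V2" for z using that dis by (auto simp: par_def)
  have sub: "V1 \<subseteq> V" "V2 \<subseteq> V" "W1 \<subseteq> V" "W2 \<subseteq> V" "{r1, r2} \<subseteq> V"
    using r E_in_V E_in_V' by (auto simp: V1_def V2_def W1_def W2_def)
  have tree: "two_rooted_tree r1 r2 V1 V2 W1 W2 par"
  proof
    show "finite V1" "finite V2" "finite W1" "finite W2"
      using sub finite_V finite_subset by blast+
    show "par z \<in> V1" if "z \<in> W1" for z using that par_eq1 by (auto simp: W1_def)
    show "par z \<in> V2" if "z \<in> W2" for z using that par_eq2 by (auto simp: W2_def)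
  qed (use dis rV r' par_V par_V' in auto)
  interpret two_rooted_tree r1 r2 V1 V2 W1 W2 par by (rule tree)
  have end1: "last (r1 # q) \<in> nodes" if q: "path (r1 # q)" "q \<noteq> [] \<longrightarrow> hd q \<noteq> r2" for q
  proof -
    have "length q \<le> 2" using far1[OF q(1)] q(2) by (cases q) simp_all
    from path_list_le_2[OF q(1) this]
    consider "q = []" | v where "q = [v]" "E r1 v"
      | v w where "q = [v, w]" "E r1 v" "E v w" "w \<noteq> r1" by blast
    then show ?thesis
    proof cases
      case 2
      then have "v \<in> V1" using q(2) by (simp add: V1_def)
      then show ?thesis using 2 by (simp add: nodes_def)
    next
      case 3
      then have "w \<in> W1" using q(2) by (auto simp: V1_def W1_def)
      then show ?thesis using 3 by (simp add: nodes_def)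
    qed (simp add: nodes_def)
  qed
  have end2: "last (r2 # q) \<in> nodes" if q: "path (r2 # q)" "q \<noteq> [] \<longrightarrow> hd q \<noteq> r1" for q
  proof -
    have "length q \<le> 2" using far2[OF q(1)] q(2) by (cases q) simp_all
    from path_list_le_2[OF q(1) this]
    consider "q = []" | v where "q = [v]" "E r2 v"
      | v w where "q = [v, w]" "E r2 v" "E v w" "w \<noteq> r2" by blast
    then show ?thesis
    proof cases
      case 2
      then have "v \<in> V2" using q(2) by (simp add: V2_def)
      then show ?thesis using 2 by (simp add: nodes_def)
    next
      case 3
      then have "w \<in> W2" using q(2) by (auto simp: V2_def W2_def)
      then show ?thesis using 3 by (simp add: nodes_def)
    qed (simp add: nodes_def)
  qed
  have cover: "V \<subseteq> nodes"
  proof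
    fix z assume z: "z \<in> V"
    obtain p where p: "path p" "p \<noteq> []" "hd p = r1" "last p = z"
      using short_path[of r1 z] z sub by blast
    then obtain q where q: "p = r1 # q" by (cases p) simp_all
    show "z \<in> nodes"
    proof (cases "q \<noteq> [] \<longrightarrow> hd q \<noteq> r2")
      case True
      then show ?thesis using end1[of q] p q by simp
    next
      case False
      then obtain q' where q': "q = r2 # q'" by (cases q) simp_all
      have "path (r2 # q')" using p(1) unfolding q q' by simp
      moreover have "q' \<noteq> [] \<longrightarrow> hd q' \<noteq> r1" using p(1) unfolding q q' by (cases q') auto
      ultimately have "last (r2 # q') \<in> nodes" by (rule end2)
      then show ?thesis using p(4) q q' by simp
    qed
  qed
  have "nodes \<subseteq> V" using sub unfolding nodes_def by simp
  then have nodes: "V = nodes" using cover by simp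
  have W1_end: "y = v" if "v \<in> V1" "E v w" "w \<noteq> r1" "E w y" for v w y
  proof (rule ccontr)
    assume "y \<noteq> v"
    then have "path [r1, v, w, y]"
      using that no_triangle[of r1 v w] E_irrefl by (auto simp: V1_def)
    from far1[OF this] show False using that by (auto simp: V1_def)
  qed
  have W2_end: "y = v" if "v \<in> V2" "E v w" "w \<noteq> r2" "E w y" for v w y
  proof (rule ccontr)
    assume "y \<noteq> v"
    then have "path [r2, v, w, y]"
      using that no_triangle[of r2 v w] E_irrefl by (auto simp: V2_def)
    from far2[OF this] show False using that by (auto simp: V2_def)
  qed
  show thesis
  proof (rule that[OF tree nodes r])
    show "E (par z) z" if z: "z \<in> V - {r1, r2}" for z
    proof -
      have "z \<in> V1 \<union> V2 \<union> W1 \<union> W2" using z nodes by (auto simp: nodes_def)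
      then consider "z \<in> V1" | "z \<in> V2" | "z \<in> W1" | "z \<in> W2" by blast
      then show ?thesis
      proof cases
        case 1
        then show ?thesis using V1(1) par_V by simp
      next
        case 2
        then show ?thesis using V2(1) par_V' by simp
      next
        case 3
        then show ?thesis using W1 par_eq1 by metis
      next
        case 4
        then show ?thesis using W2 par_eq2 by metis
      qed
    qed
    fix x y assume xy: "E x y"
    have "x \<in> nodes" using E_in_V[OF xy] nodes by simp
    then consider "x = r1" | "x = r2" | "x \<in> V1" | "x \<in> V2" | "x \<in> W1" | "x \<in> W2"
      by (auto simp: nodes_def)
    then show "{x, y} = {r1, r2} \<or> x \<notin> {r1, r2} \<and> y = par x \<or> y \<notin> {r1, r2} \<and> x = par y"
    proof cases
      case 1
      then show ?thesis using xy par_V[of y] rV E_irrefl by (cases "y = r2") (auto simp: V1_def)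
    next
      case 2
      then show ?thesis using xy par_V'[of y] rV E_irrefl by (cases "y = r1") (auto simp: V2_def)
    next
      case 3
      have "y \<noteq> r2" using 3 xy no_triangle[of r1 x r2] r' by (auto simp: V1_def)
      then show ?thesis using 3 xy par_eq1[of x y] par_V[of x] V1(3,4)[of x] by (cases "y = r1") auto
    next
      case 4
      have "y \<noteq> r1" using 4 xy no_triangle[of r2 x r1] r by (auto simp: V2_def)
      then show ?thesis using 4 xy par_eq2[of x y] par_V'[of x] V2(3,4)[of x] by (cases "y = r2") auto
    next
      case 5
      then obtain v where v: "v \<in> V1" "E v x" "x \<noteq> r1" by (auto simp: W1_def)
      then show ?thesis using W1_end[OF v xy] par_eq1[OF v] dis 5 by auto
    next
      case 6
      then obtain v where v: "v \<in> V2" "E v x" "x \<noteq> r2" by (auto simp: W2_def)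
      then show ?thesis using W2_end[OF v xy] par_eq2[OF v] dis 6 by auto
    qed
  qed
qed

end

section \<open>Trees given as symmetric digraphs\<close>

lemma (in pair_wf_digraph) successively_awalk_verts:
  "awalk u p v \<Longrightarrow> successively (\<lambda>x y. (x, y) \<in> parcs G) (pawalk_verts u p)"
proof (induction p arbitrary: u)
  case (Cons e p)
  then have "awalk (snd e) p v" "(u, snd e) \<in> parcs G" "fst e = u" by (auto simp: awalk_Cons_iff)
  moreover have "hd (pawalk_verts (snd e) p) = snd e" by (cases p) (use calculation(1) in \<open>auto simp: awalk_Cons_iff\<close>)
  moreover have "pawalk_verts (snd e) p \<noteq> []" by (cases p) auto
  ultimately show ?case using Cons.IH[of "snd e"] by (simp add: successively_Cons)
qed simp

lemma (in pair_wf_digraph) awalk_vwalk_arcs: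
  "successively (\<lambda>x y. (x, y) \<in> parcs G) (x # xs) \<Longrightarrow> x \<in> pverts G \<Longrightarrow>
     awalk x (vwalk_arcs (x # xs)) (last (x # xs)) \<and> pawalk_verts x (vwalk_arcs (x # xs)) = x # xs"
proof (induction xs arbitrary: x)
  case Nil
  then show ?case by (simp add: awalk_Nil_iff)
next
  case (Cons y xs)
  then have "(x, y) \<in> parcs G" "y \<in> pverts G" by (auto dest: in_arcsD2)
  then show ?case using Cons by (simp add: awalk_Cons_iff)
qed

lemma (in pair_fin_digraph) exists_path_of_length_dist:
  assumes "graph_dist G u v \<le> ereal (real d)"
  shows "\<exists>xs. distinct xs \<and> successively (\<lambda>x y. (x, y) \<in> parcs G) xs \<and> xs \<noteq> [] \<and> hd xs = u \<and>
    last xs = v \<and> length xs \<le> d + 1"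
proof -
  have "\<mu> (\<lambda>_. 1) u v < \<infinity>"
    using assms unfolding graph_dist_def 
    by (metis ereal_infty_less(1) ereal_infty_less_eq(1) less_ereal.simps(1) not_le
        PInfty_neq_ereal(1))
  from min_cost_awalk[OF \<mu>_reach_conv[THEN iffD1, OF this], of "\<lambda>_. 1"]
  obtain p where p: "apath u p v" "\<mu> (\<lambda>_. 1) u v = awalk_cost (\<lambda>_. 1) p"
    by auto
  have "awalk_cost (\<lambda>_. 1) p = real (length p)" by (induction p) auto
  then have "length p \<le> d" using assms p(2) unfolding graph_dist_def by simp
  moreover have "awalk u p v" "distinct (pawalk_verts u p)" using p(1) by (auto simp: apath_def)
  moreover have "hd (pawalk_verts u p) = u" "last (pawalk_verts u p) = v"
    using calculation(2) awalkE by metis+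
  moreover have "pawalk_verts u p \<noteq> []" by (cases p) auto
  ultimately show ?thesis
    using successively_awalk_verts length_awalk_verts[of u p] by (metis Suc_eq_plus1 Suc_le_mono)
qed

text \<open>
  A closed vertex list \<open>xs\<close> is turned into a cycle of arcs by starting the walk at its last vertex:
  the vertices of the walk after the first one are then exactly \<open>xs\<close>.
\<close>

lemma tree_diameter_5_pverts:
  assumes T: "undirected_tree T" and diam: "graph_diameter T \<le> 5"
  shows "tree_diameter_5 (pverts T) (\<lambda>x y. (x, y) \<in> parcs T)"
proof -
  interpret pair_graph T using T by (simp add: undirected_tree_def)
  show ?thesis
  proof
    show "finite (pverts T)" by (rule pair_finite_verts)
    show "x \<in> pverts T" if "(x, y) \<in> parcs T" for x y using that by (rule in_arcsD1)
    show "(y, x) \<in> parcs T" if "(x, y) \<in> parcs T" for x y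
      using that pair_sym_arcs by (auto simp: symmetric_def dest: symD)
    show "(x, x) \<notin> parcs T" for x using pair_no_loops by fastforce
    show "(last xs, hd xs) \<notin> parcs T"
      if xs: "distinct xs" "successively (\<lambda>x y. (x, y) \<in> parcs T) xs" "3 \<le> length xs" for xs
    proof
      assume closing: "(last xs, hd xs) \<in> parcs T"
      obtain x ys where x: "xs = x # ys" using xs(3) by (cases xs) auto
      let ?ws = "vwalk_arcs (last xs # xs)"
      have "awalk (last xs) ?ws (last xs) \<and> pawalk_verts (last xs) ?ws = last xs # xs"
        using awalk_vwalk_arcs[of "last xs" xs] closing xs(2) x in_arcsD1 by simp
      moreover have "length ?ws = length xs"
        using vwalk_length_simp[of "last xs # xs", unfolded vwalk_length_def] by simp
      moreover have "?ws \<noteq> []" using x by simp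
      ultimately have "cycle ?ws" "length ?ws \<ge> 3" using xs(1,3) unfolding cycle_def by auto
      then show False using T unfolding undirected_tree_def by blast
    qed
    show "\<exists>xs. distinct xs \<and> successively (\<lambda>x y. (x, y) \<in> parcs T) xs \<and> xs \<noteq> [] \<and>
        hd xs = x \<and> last xs = y \<and> length xs \<le> 6" if "x \<in> pverts T" "y \<in> pverts T" for x y
    proof -
      have "graph_dist T x y \<le> graph_diameter T"
        unfolding graph_diameter_def using that by (intro SUP_upper2[of x] SUP_upper)
      then have "graph_dist T x y \<le> ereal (real 5)" using diam by simp
      from exists_path_of_length_dist[OF this] show ?thesis by simp
    qed
  qed
qed

lemma (in tree_diameter_5) vertices_equal_if_no_edge:
  assumes "\<And>x y. \<not> E x y" "x \<in> V" "y \<in> V"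
  shows "x = y"
proof -
  obtain xs where xs: "successively E xs" "xs \<noteq> []" "hd xs = x" "last xs = y"
    using short_path assms(2,3) by blast
  then obtain ys where "xs = x # ys" by (cases xs) auto
  then show ?thesis using xs assms(1) by (cases ys) auto
qed

theorem theorem2:
  fixes k n :: nat
    and G :: "'a pair_pre_digraph"
    and T :: "'b pair_pre_digraph"
  assumes "k \<ge> 1" and "n \<ge> 1"
    and "pair_graph G" and "card (pverts G) = n"
    and "real (card {v \<in> pverts G. out_degree (with_proj G) v \<ge> k}) \<ge> real n / 2"
    and "undirected_tree T"
    and "graph_diameter T \<le> 5"
    and "card (undirected_edges T) \<le> k"
  shows "contained_in T G"
proof -
  let ?E = "\<lambda>x y. (x, y) \<in> parcs T" and ?H = "\<lambda>x y. (x, y) \<in> parcs G"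
  interpret G: pair_graph G by (rule assms(3))
  interpret T: pair_graph T using assms(6) by (simp add: undirected_tree_def)
  interpret tree_diameter_5 "pverts T" ?E by (rule tree_diameter_5_pverts[OF assms(6,7)])
  interpret host: finite_graph "pverts G" ?H
  proof
    show "finite (pverts G)" by (rule G.pair_finite_verts)
    show "x \<in> pverts G" if "(x, y) \<in> parcs G" for x y using that by (rule G.in_arcsD1)
    show "(y, x) \<in> parcs G" if "(x, y) \<in> parcs G" for x y
      using that G.pair_sym_arcs by (auto simp: symmetric_def dest: symD)
    show "(x, x) \<notin> parcs G" for x using G.pair_no_loops by fastforce
  qed
  have nonempty: "pverts G \<noteq> {}" using assms(2,4) by auto
  show ?thesis
  proof (cases "\<exists>a b. ?E a b")
    case False
    obtain g where "g \<in> pverts G" using nonempty by blast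
    then have "(\<lambda>_. g) ` pverts T \<subseteq> pverts G" by blast
    moreover have "inj_on (\<lambda>_. g) (pverts T)"
      by (rule inj_onI) (use vertices_equal_if_no_edge False in blast)
    ultimately show ?thesis using False unfolding contained_in_def by blast
  next
    case True
    then obtain a b where ab: "?E a b" by blast
    obtain r1 r2 V1 V2 W1 W2 par
      where tree: "two_rooted_tree r1 r2 V1 V2 W1 W2 par"
        and nodes: "pverts T = two_rooted_tree.nodes r1 r2 V1 V2 W1 W2"
        and root_arc: "?E r1 r2" and par_arc: "\<And>z. z \<in> pverts T - {r1, r2} \<Longrightarrow> ?E (par z) z"
        and arcs: "\<And>x y. ?E x y \<Longrightarrow> {x, y} = {r1, r2} \<or> x \<notin> {r1, r2} \<and> y = par x \<or>
          y \<notin> {r1, r2} \<and> x = par y"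
      by (rule exists_two_rooted_structure[OF ab], rule that)
    interpret tree: two_rooted_tree r1 r2 V1 V2 W1 W2 par by (rule tree)
    have edges: "undirected_edges T = (\<lambda>(u, v). {u, v}) ` parcs T"
      unfolding undirected_edges_def by auto
    have "card tree.nodes \<le> card (undirected_edges T) + 1"
    proof (rule tree.card_nodes_le_edges)
      show "finite (undirected_edges T)" unfolding edges using T.pair_finite_arcs by simp
      show "{r1, r2} \<in> undirected_edges T" using root_arc unfolding undirected_edges_def by blast
      show "{par z, z} \<in> undirected_edges T" if "z \<in> tree.nodes - {r1, r2}" for z
        using par_arc[of z] that nodes unfolding undirected_edges_def by blast
    qed
    then have small: "card tree.nodes \<le> k + 1" using assms(8) by simp
    define L where "L = {v \<in> pverts G. k \<le> card (host.nbrs (pverts G) v)}"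
    have degree: "out_degree (with_proj G) v = card (host.nbrs (pverts G) v)" for v
    proof -
      have "host.nbrs (pverts G) v = {w. (v, w) \<in> parcs G}"
        unfolding host.nbrs_def using G.in_arcsD2 by blast
      then show ?thesis by (simp add: out_degree_eq_card_neighbours)
    qed
    have half: "card (pverts G) \<le> 2 * card L"
      using assms(4,5) unfolding L_def degree by linarith
    interpret tree_in_graph "pverts G" ?H r1 r2 V1 V2 W1 W2 par k L
    proof
      show "L \<subseteq> pverts G" by (auto simp: L_def)
      show "k \<le> card (host.nbrs (pverts G) v)" if "v \<in> L" for v using that by (simp add: L_def)
    qed (rule small)
    obtain f where f: "partial_embedding tree.nodes f"
      using exists_embedding[OF assms(1) nonempty L_def half] by blast
    have root_edge: "?H (f r1) (f r2)" using f by (simp add: partial_embedding_def)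
    have par_edge: "?H (f (par z)) (f z)" if "z \<in> pverts T - {r1, r2}" for z
      using f that unfolding nodes partial_embedding_def by blast
    have "?H (f x) (f y)" if xy: "?E x y" for x y
    proof -
      have V: "x \<in> pverts T" "y \<in> pverts T" using xy T.in_arcsD1 T.in_arcsD2 by blast+
      from arcs[OF xy] consider "x = r1 \<and> y = r2 \<or> x = r2 \<and> y = r1"
        | "x \<notin> {r1, r2}" "y = par x" | "y \<notin> {r1, r2}" "x = par y"
        by (auto simp: doubleton_eq_iff)
      then show ?thesis
      proof cases
        case 1
        then show ?thesis using root_edge host.E_sym[OF root_edge] by blast
      next
        case 2
        then show ?thesis using host.E_sym[OF par_edge[of x]] V by blast
      next
        case 3
        then show ?thesis using par_edge[of y] V by blast
      qed
    qed
    then show ?thesis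
      using f unfolding contained_in_def partial_embedding_def nodes by blast
  qed
qed

end
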